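(* Let $n\ge 1$, let $D_n\subseteq\Sigma_n$ be the set of derangements (permutations with no fixed points) and set $P_n=\Sigma_n\setminus D_n$. Then the complex of injective words $|X(P_n)|$ generated by $P_n$ is contractible.
   Context: An injective word in the alphabet $[n]=\{1,\dots,n\}$ is a sequence $w=[i_1\cdots i_k]$ of distinct elements of $[n]$; a subword of $w$ is a subsequence, and $v\preceq w$ denotes the subword relation. A permutation $\sigma\in\Sigma_n$ is identified with the injective word $[\sigma(1)\cdots\sigma(n)]$ of length $n$. For $S\subseteq\Sigma_n$, $X(S)$ is the set of all non-empty injective words $t$ with $t\preceq s$ for some $s\in S$, partially ordered by $\preceq$. The complex $|X(S)|$ is the geometric realization of the semi-simplicial set whose $k$-simplices are the words of length $k+1$ in $X(S)$, with the $i$-th face map ($0\le i\le k$) deleting the $(i+1)$-st letter; thus it is a cell complex with one $(k-1)$-simplex $\Delta(w)$ for each word $w$ of length $k$ in $X(S)$, with $\Delta(v)$ identified with the corresponding face of $\Delta(w)$ when $v\preceq w$. *)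

theory Defs
  imports "HOL-Homology.Homology" "HOL-Combinatorics.Permutations" "HOL-Library.Sublist"
begin

definition quotient_topology :: "'a topology \<Rightarrow> ('a \<Rightarrow> 'b) \<Rightarrow> 'b topology" where
  "quotient_topology X q =
     topology (\<lambda>U. U \<subseteq> q ` topspace X \<and> openin X {x \<in> topspace X. q x \<in> U})"

lemma openin_quotient_topology:
  "openin (quotient_topology X q) U \<longleftrightarrow>
     U \<subseteq> q ` topspace X \<and> openin X {x \<in> topspace X. q x \<in> U}"
proof -
  have 1: "{x \<in> topspace X. q x \<in> A \<inter> B} = {x \<in> topspace X. q x \<in> A} \<inter> {x \<in> topspace X. q x \<in> B}"
    for A B by auto
  have 2: "{x \<in> topspace X. q x \<in> \<Union>\<K>} = (\<Union>K\<in>\<K>. {x \<in> topspace X. q x \<in> K})" for \<K>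
    by auto
  have "istopology (\<lambda>U. U \<subseteq> q ` topspace X \<and> openin X {x \<in> topspace X. q x \<in> U})"
    unfolding istopology_def 1 2 by blast
  then show ?thesis
    by (simp add: quotient_topology_def)
qed

lemma topspace_quotient_topology [simp]:
  "topspace (quotient_topology X q) = q ` topspace X"
proof -
  have "{x \<in> topspace X. q x \<in> q ` topspace X} = topspace X"
    by auto
  then have "openin (quotient_topology X q) (q ` topspace X)"
    by (simp add: openin_quotient_topology)
  then show ?thesis
    by (meson openin_quotient_topology openin_subset openin_topspace subset_antisym)
qed

lemma quotient_map_quotient_topology: "quotient_map X (quotient_topology X q) q"
  by (auto simp: quotient_map_def openin_quotient_topology)


text \<open>
  A semi-simplicial set is given by its sets \<open>K p\<close> of \<open>p\<close>-simplices and its face maps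
  \<open>d p i\<close>, sending \<open>K p\<close> to \<open>K (p - 1)\<close> for \<open>0 < p\<close> and \<open>i \<le> p\<close>.
\<close>

definition semisimplicial_set :: "(nat \<Rightarrow> 'a set) \<Rightarrow> (nat \<Rightarrow> nat \<Rightarrow> 'a \<Rightarrow> 'a) \<Rightarrow> bool" where
  "semisimplicial_set K d \<longleftrightarrow>
     (\<forall>p. \<forall>x \<in> K (Suc p). \<forall>i \<le> Suc p. d (Suc p) i x \<in> K p) \<and>
     (\<forall>p. \<forall>x \<in> K (Suc (Suc p)). \<forall>j \<le> Suc (Suc p). \<forall>i < j.
        d (Suc p) i (d (Suc (Suc p)) j x) = d (Suc p) (j - 1) (d (Suc (Suc p)) i x))"

text \<open>
  The generating identifications: the library's \<open>simplical_face i\<close> inserts a zero coordinate at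
  position \<open>i\<close>, i.e. it is the inclusion of the standard \<open>p\<close>-simplex as the face of the standard
  \<open>(p + 1)\<close>-simplex opposite to vertex \<open>i\<close>.
\<close>

inductive face_identification ::
    "(nat \<Rightarrow> 'a set) \<Rightarrow> (nat \<Rightarrow> nat \<Rightarrow> 'a \<Rightarrow> 'a) \<Rightarrow>
     (nat \<times> 'a) \<times> (nat \<Rightarrow> real) \<Rightarrow> (nat \<times> 'a) \<times> (nat \<Rightarrow> real) \<Rightarrow> bool"
  for K d where
  "\<lbrakk>x \<in> K (Suc p); i \<le> Suc p; t \<in> standard_simplex p\<rbrakk> \<Longrightarrow>
     face_identification K d ((p, d (Suc p) i x), t) ((Suc p, x), simplical_face i t)"

definition geometric_realization ::
    "(nat \<Rightarrow> 'a set) \<Rightarrow> (nat \<Rightarrow> nat \<Rightarrow> 'a \<Rightarrow> 'a) \<Rightarrow> ((nat \<times> 'a) \<times> (nat \<Rightarrow> real)) set topology" where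
  "geometric_realization K d =
     quotient_topology
       (sum_topology (\<lambda>(p, x). subtopology (powertop_real UNIV) (standard_simplex p))
          (SIGMA p:UNIV. K p))
       (\<lambda>z. {z'. equivclp (face_identification K d) z z'})"


definition injective_word :: "nat \<Rightarrow> nat list \<Rightarrow> bool" where
  "injective_word n w \<longleftrightarrow> distinct w \<and> set w \<subseteq> {1..n}"

definition perms :: "nat \<Rightarrow> (nat \<Rightarrow> nat) set" where
  "perms n = {\<sigma>. \<sigma> permutes {1..n}}"

definition derangements :: "nat \<Rightarrow> (nat \<Rightarrow> nat) set" where
  "derangements n = {\<sigma> \<in> perms n. \<forall>i \<in> {1..n}. \<sigma> i \<noteq> i}"

definition perm_word :: "nat \<Rightarrow> (nat \<Rightarrow> nat) \<Rightarrow> nat list" where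
  "perm_word n \<sigma> = map \<sigma> [1..<Suc n]"

definition generated_words :: "nat \<Rightarrow> (nat \<Rightarrow> nat) set \<Rightarrow> nat list set" where
  "generated_words n S =
     {t. injective_word n t \<and> t \<noteq> [] \<and> (\<exists>\<sigma> \<in> S. subseq t (perm_word n \<sigma>))}"

definition word_simplices :: "nat \<Rightarrow> (nat \<Rightarrow> nat) set \<Rightarrow> nat \<Rightarrow> nat list set" where
  "word_simplices n S p = {w \<in> generated_words n S. length w = Suc p}"

text \<open>Positions in a list are counted from \<open>0\<close>, so this deletes the \<open>(i + 1)\<close>-st letter.\<close>

definition word_face :: "nat \<Rightarrow> nat \<Rightarrow> nat list \<Rightarrow> nat list" where
  "word_face p i w = take i w @ drop (Suc i) w"

definition injective_word_complex ::
    "nat \<Rightarrow> (nat \<Rightarrow> nat) set \<Rightarrow> ((nat \<times> nat list) \<times> (nat \<Rightarrow> real)) set topology" where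
  "injective_word_complex n S = geometric_realization (word_simplices n S) word_face"

lemma subseq_word_face: "subseq (word_face p i w) w"
proof -
  have "subseq (drop (Suc i) w) (drop i w)"
    unfolding drop_Suc tl_drop [symmetric] by (intro suffix_imp_subseq suffix_tl)
  then have "subseq (take i w @ drop (Suc i) w) (take i w @ drop i w)"
    by (simp only: subseq_append')
  then show ?thesis
    by (simp only: append_take_drop_id word_face_def)
qed

lemma semisimplicial_word_simplices: "semisimplicial_set (word_simplices n S) word_face"
proof -
  have "word_face (Suc p) i w \<in> word_simplices n S p"
    if w: "w \<in> word_simplices n S (Suc p)" and i: "i \<le> Suc p" for p i w
  proof -
    have len: "length (word_face (Suc p) i w) = Suc p"
      using w i by (auto simp: word_simplices_def word_face_def)
    have sub: "subseq (word_face (Suc p) i w) w"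
      by (rule subseq_word_face)
    have "injective_word n w"
      using w by (auto simp: word_simplices_def generated_words_def)
    then have "injective_word n (word_face (Suc p) i w)"
      unfolding injective_word_def word_face_def
      using set_take_subset[of i w] set_drop_subset[of "Suc i" w]
        set_take_disj_set_drop_if_distinct[of w i "Suc i"]
      by auto
    moreover have "\<exists>\<sigma> \<in> S. subseq (word_face (Suc p) i w) (perm_word n \<sigma>)"
      using w sub by (auto simp: word_simplices_def generated_words_def intro: subseq_order.trans)
    ultimately show ?thesis
      using len by (auto simp: word_simplices_def generated_words_def)
  qed
  moreover have "word_face (Suc p) i (word_face (Suc (Suc p)) j w)
      = word_face (Suc p) (j - 1) (word_face (Suc (Suc p)) i w)"
    if "length w = Suc (Suc (Suc p))" "j \<le> Suc (Suc p)" "i < j" for p i j and w :: "nat list"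
  proof -
    obtain k where "j = Suc (i + k)"
      using \<open>i < j\<close> less_iff_Suc_add by blast
    with that show ?thesis
      by (intro nth_equalityI) (auto simp: word_face_def nth_append min_def)
  qed
  ultimately show ?thesis
    by (auto simp: semisimplicial_set_def word_simplices_def)
qed

text \<open>
  The library predicate \<open>contractible_space\<close> holds of the empty space; the following shows that
  this case does not arise for the complex generated by the non-derangements.
\<close>

lemma injective_word_complex_nonempty:
  assumes "n \<ge> 1"
  shows "topspace (injective_word_complex n (perms n - derangements n)) \<noteq> {}"
proof -
  have "id \<in> perms n - derangements n"
    using assms by (auto simp: perms_def derangements_def permutes_id)
  moreover have "subseq [1] (perm_word n id)"
    using assms by (auto simp: perm_word_def subseq_singleton_left simp del: upt_Suc)
  ultimately have "[1] \<in> word_simplices n (perms n - derangements n) 0"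
    using assms unfolding word_simplices_def generated_words_def injective_word_def
    by (auto intro!: bexI[of _ id])
  then have "((0, [1]), \<lambda>j. if j = 0 then 1 else 0) \<in>
      topspace (sum_topology (\<lambda>(p, x). subtopology (powertop_real UNIV) (standard_simplex p))
        (SIGMA p:UNIV. word_simplices n (perms n - derangements n) p))"
    by (simp add: standard_simplex_0)
  then show ?thesis
    unfolding injective_word_complex_def geometric_realization_def topspace_quotient_topology
    by blast
qed

end

theory Submission
  imports Defs
begin

text \<open>
  Attach the facets of the complex one at a time, ordered by total displacement with a suitable
  tie breaker. If \<open>m\<close> is not fixed by \<open>\<sigma>\<close>, moving the letter \<open>m\<close> to position \<open>m\<close> gives an earlier
  permutation, which has a fixed point and shares with \<open>\<sigma>\<close> the face opposite to \<open>m\<close>.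
  Conversely, any other permutation containing all nonfixed letters of \<open>\<sigma>\<close> in the same order
  comes later, because moving the fixed letters of \<open>\<sigma>\<close> home in it leads down to \<open>\<sigma>\<close>.
  So the simplex of \<open>\<sigma>\<close> meets the union of the earlier ones precisely in the faces that omit
  some nonfixed letter. All these faces contain a fixed letter of \<open>\<sigma>\<close>, so the simplex deforms
  onto their union, and contractibility persists at each step.

  The topology is handled in a compact subset of a product of real lines that is homeomorphic to
  the realization.
\<close>

section \<open>A potential on permutations\<close>

text \<open>
  Here and below \<open>p\<close> sends a letter to its position, so it is the inverse of the permutation
  whose word is considered. Deleting the letter \<open>m\<close> from that word and inserting it again at
  position \<open>m\<close> gives the word with position function \<open>move_home p m\<close>.
\<close>

definition move_home :: "(nat \<Rightarrow> nat) \<Rightarrow> nat \<Rightarrow> nat \<Rightarrow> nat" where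
  "move_home p m j =
     (if j = m then m
      else if p m < p j \<and> p j \<le> m then p j - 1
      else if m \<le> p j \<and> p j < p m then p j + 1
      else p j)"

lemma move_home_self [simp]: "move_home p m m = m"
  by (simp add: move_home_def)

text \<open>Closing the gap at \<open>p m\<close> and opening one at \<open>m\<close> shifts the
  other positions monotonically; injectivity keeps them off \<open>p m\<close>, so no two of them
  collide.\<close>

lemma move_home_le_iff:
  assumes "inj p" "i \<noteq> m" "j \<noteq> m"
  shows "move_home p m i \<le> move_home p m j \<longleftrightarrow> p i \<le> p j"
proof -
  have "p i \<noteq> p m" "p j \<noteq> p m" "p i = p j \<longleftrightarrow> i = j"
    using assms by (auto simp: inj_eq)
  then show ?thesis
    using assms(2,3) unfolding move_home_def by (cases "i = j") auto
qed

lemma move_home_permutes: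
  assumes p: "p permutes {1..n}" and m: "m \<in> {1..n}"
  shows "move_home p m permutes {1..n}"
proof -
  have inj: "inj p" and range: "\<And>j. j \<in> {1..n} \<Longrightarrow> p j \<in> {1..n}"
    using permutes_inj[OF p] permutes_in_image[OF p] by blast+
  have eqD: "p i = p j \<Longrightarrow> i = j" for i j
    using inj by (simp add: inj_eq)
  have "move_home p m ` {1..n} \<subseteq> {1..n}"
  proof safe
    fix j assume "j \<in> {1..n}"
    then show "move_home p m j \<in> {1..n}"
      using range[of j] range[OF m] m by (auto simp: move_home_def)
  qed
  moreover have "inj_on (move_home p m) {1..n}"
  proof (rule inj_onI)
    fix i j assume ij: "i \<in> {1..n}" "j \<in> {1..n}" and eq: "move_home p m i = move_home p m j"
    show "i = j"
    proof (cases "i = m \<or> j = m")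
      case False
      then show ?thesis
        using move_home_le_iff[OF inj, of i m j] move_home_le_iff[OF inj, of j m i] eq eqD by auto
    next
      case True
      have "move_home p m k \<noteq> m" if "k \<noteq> m" for k
        using that eqD[of k m] unfolding move_home_def by auto
      with True eq show ?thesis
        by (metis move_home_self)
    qed
  qed
  ultimately have "bij_betw (move_home p m) {1..n} {1..n}"
    by (simp add: bij_betw_def endo_inj_surj)
  moreover have "move_home p m j = j" if "j \<notin> {1..n}" for j
  proof -
    have "p j = j" using p that by (rule permutes_not_in)
    then show ?thesis
      using that m range[OF m] by (auto simp: move_home_def)
  qed
  ultimately show ?thesis
    by (rule bij_imp_permutes)
qed

text \<open>Truncated subtraction makes each summand an absolute difference, so this is Spearman's
  footrule distance from \<open>p\<close> to the identity.\<close>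

definition displacement :: "nat \<Rightarrow> (nat \<Rightarrow> nat) \<Rightarrow> nat" where
  "displacement n p = (\<Sum>j=1..n. (j - p j) + (p j - j))"

text \<open>Both sums are binary numbers: among letters displaced to the left the largest dominates,
  among those displaced to the right the smallest.\<close>

definition tie_breaker :: "nat \<Rightarrow> (nat \<Rightarrow> nat) \<Rightarrow> nat" where
  "tie_breaker n p =
     (\<Sum>j | j \<in> {1..n} \<and> p j < j. 2 ^ j) + (\<Sum>j | j \<in> {1..n} \<and> j < p j. 2 ^ (n + 1 - j))"

text \<open>
  The factor exceeds every value of \<open>tie_breaker n\<close>, so the potential orders permutations
  lexicographically by displacement and then by tie breaker.
\<close>

definition potential :: "nat \<Rightarrow> (nat \<Rightarrow> nat) \<Rightarrow> nat" where
  "potential n p = displacement n p * 2 ^ (n + 2) + tie_breaker n p"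

lemma sum_power2_lt:
  fixes f :: "'a \<Rightarrow> nat"
  assumes "finite A" "inj_on f A" "\<And>x. x \<in> A \<Longrightarrow> f x < k"
  shows "(\<Sum>x\<in>A. 2 ^ f x) < (2::nat) ^ k"
proof -
  have "(\<Sum>x\<in>A. 2 ^ f x) = (\<Sum>i\<in>f ` A. (2::nat) ^ i)"
    using assms(2) by (simp add: sum.reindex)
  also have "\<dots> \<le> (\<Sum>i<k. 2 ^ i)"
    using assms(3) by (intro sum_mono2) auto
  also have "\<dots> < 2 ^ k"
    by (simp add: lessThan_atLeast0 sum_power2)
  finally show ?thesis .
qed

text \<open>Whatever \<open>B\<close> has beyond \<open>A - {a}\<close> uses distinct exponents
  below \<open>f a\<close>, and so weighs less in total than the single term of
  \<open>a\<close>.\<close>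

lemma sum_power2_less:
  fixes f :: "'a \<Rightarrow> nat"
  assumes fin: "finite A" "finite B" and inj: "inj_on f B"
    and a: "a \<in> A" and dom: "\<And>x. x \<in> B \<Longrightarrow> f x < f a \<or> (x \<in> A \<and> x \<noteq> a)"
  shows "(\<Sum>x\<in>B. 2 ^ f x) < (\<Sum>x\<in>A. (2::nat) ^ f x)"
proof -
  have "(\<Sum>x\<in>B. 2 ^ f x) = (\<Sum>x\<in>{x\<in>B. f x < f a}. 2 ^ f x) + (\<Sum>x\<in>{x\<in>B. \<not> f x < f a}. (2::nat) ^ f x)"
    using fin(2) by (subst sum.union_disjoint[symmetric]) (auto intro: sum.cong)
  also have "(\<Sum>x\<in>{x\<in>B. f x < f a}. 2 ^ f x) < (2::nat) ^ f a"
    using fin(2) inj by (intro sum_power2_lt) (auto intro: inj_on_subset)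
  also have "(\<Sum>x\<in>{x\<in>B. \<not> f x < f a}. (2::nat) ^ f x) \<le> (\<Sum>x\<in>A - {a}. 2 ^ f x)"
    using fin(1) dom by (intro sum_mono2) auto
  also have "2 ^ f a + (\<Sum>x\<in>A - {a}. 2 ^ f x) = (\<Sum>x\<in>A. (2::nat) ^ f x)"
    using fin(1) a by (simp add: sum.remove)
  finally show ?thesis by simp
qed

lemma tie_breaker_lt: "tie_breaker n p < 2 ^ (n + 2)"
proof -
  have "(\<Sum>j | j \<in> {1..n} \<and> p j < j. 2 ^ j) < (2::nat) ^ (n + 1)"
    by (rule sum_power2_lt) auto
  moreover have "(\<Sum>j | j \<in> {1..n} \<and> j < p j. 2 ^ (n + 1 - j)) < (2::nat) ^ (n + 1)"
    by (rule sum_power2_lt) (auto simp: inj_on_def)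
  ultimately show ?thesis
    by (simp add: tie_breaker_def)
qed

lemma potential_less_if_displacement_less:
  assumes "displacement n q < displacement n p"
  shows "potential n q < potential n p"
proof -
  have "potential n q < (displacement n q + 1) * 2 ^ (n + 2)"
    using tie_breaker_lt[of n q] by (simp add: potential_def)
  also have "\<dots> \<le> displacement n p * 2 ^ (n + 2)"
    using assms by (intro mult_right_mono) auto
  finally show ?thesis
    by (simp add: potential_def)
qed

lemma card_permutes_preimage:
  assumes p: "p permutes {1..n}" and "B \<subseteq> {1..n}"
  shows "card {j \<in> {1..n}. p j \<in> B} = card B"
proof -
  have "{j \<in> {1..n}. p j \<in> B} = p -` B"
    using assms permutes_in_image[OF p] by blast
  then show ?thesis
    using p by (simp add: card_vimage_inj permutes_inj permutes_surj)
qed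

lemma potential_move_home_less:
  assumes p: "p permutes {1..n}" and m: "m \<in> {1..n}" and nonfix: "p m \<noteq> m"
  shows "potential n (move_home p m) < potential n p"
proof -
  let ?q = "move_home p m"
  let ?d = "\<lambda>p j. (j - p j) + (p j - j) :: nat"
  \<comment> \<open>\<open>B\<close> consists of the positions that \<open>m\<close> jumps over or
    onto; one of the two intervals is empty. \<open>c\<close> marks the letters shifted by the move,
    and there are as many of them as \<open>m\<close> loses displacement.\<close>
  define B where "B = {p m<..m} \<union> {m..<p m}"
  define c where "c j = (if p j \<in> B then 1 else 0 :: nat)" for j
  have pm: "p m \<in> {1..n}"
    using permutes_in_image[OF p] m by blast
  have cm: "c m = 0" by (auto simp: c_def B_def)
  have "(\<Sum>j\<in>{1..n}. c j) = card B"
  proof -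
    have "(\<Sum>j\<in>{1..n}. c j) = card {j \<in> {1..n}. p j \<in> B}"
      by (simp add: c_def sum.If_cases Int_def)
    also have "\<dots> = card B"
      using m pm by (intro card_permutes_preimage[OF p]) (auto simp: B_def)
    finally show ?thesis .
  qed
  moreover have "card B = ?d p m"
    unfolding B_def by (subst card_Un_disjoint) auto
  ultimately have csum: "(\<Sum>j\<in>{1..n} - {m}. c j) = ?d p m"
    using m cm by (simp add: sum.remove[of _ m])
  have le: "?d ?q j \<le> ?d p j + c j" if "j \<noteq> m" for j
    using that by (auto simp: move_home_def c_def B_def)
  have dq: "displacement n ?q = (\<Sum>j\<in>{1..n} - {m}. ?d ?q j)"
    using m by (simp add: displacement_def sum.remove[of _ m])
  have dp: "displacement n p = (\<Sum>j\<in>{1..n} - {m}. ?d p j + c j)"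
    using m csum by (simp add: displacement_def sum.remove[of _ m] sum.distrib)
  txt \<open>
    The letters that \<open>m\<close> jumps over shift by one, so together they gain at most the displacement
    that \<open>m\<close> loses. In a tie each of them moves away from its own position: a letter newly
    displaced to the left (right) is then smaller (larger) than \<open>m\<close>.
  \<close>
  show ?thesis
  proof (cases "\<exists>j\<in>{1..n} - {m}. ?d ?q j < ?d p j + c j")
    case True
    then have "displacement n ?q < displacement n p"
      unfolding dq dp using le by (intro sum_strict_mono_ex1) auto
    then show ?thesis
      by (rule potential_less_if_displacement_less)
  next
    case False
    then have tie: "?d ?q j = ?d p j + c j" if "j \<in> {1..n}" "j \<noteq> m" for j
      using le[of j] that by force
    then have "displacement n ?q = displacement n p"
      unfolding dq dp by (intro sum.cong) auto
    moreover have "tie_breaker n ?q < tie_breaker n p"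
    proof (cases "p m < m")
      case True
      have between: "p j \<le> j" if "p m < p j" "p j \<le> m" for j
      proof -
        have "j \<in> {1..n}"
          using that m pm permutes_in_image[OF p, of j] by auto
        then show ?thesis
          using tie[of j] that True by (cases "j = m") (auto simp: move_home_def c_def B_def)
      qed
      \<comment> \<open>Neither \<open>m\<close> nor a letter shifted to the left is right of its
        home before or after the move, so only the first sum of the tie breaker changes.\<close>
      have "{j. j \<in> {1..n} \<and> j < ?q j} = {j. j \<in> {1..n} \<and> j < p j}"
        using True by (auto simp: move_home_def dest: between split: if_splits)
      moreover have "(\<Sum>j | j \<in> {1..n} \<and> ?q j < j. 2 ^ j) < (\<Sum>j | j \<in> {1..n} \<and> p j < j. (2::nat) ^ j)"
        by (rule sum_power2_less[where a = m])
          (use True m in \<open>auto simp: move_home_def dest: between split: if_splits\<close>)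
      ultimately show ?thesis
        by (simp add: tie_breaker_def)
    next
      case False
      have between: "j \<le> p j" if "p j < p m" "m \<le> p j" for j
      proof -
        have "j \<in> {1..n}"
          using that m pm permutes_in_image[OF p, of j] by auto
        then show ?thesis
          using tie[of j] that False by (cases "j = m") (auto simp: move_home_def c_def B_def)
      qed
      \<comment> \<open>The mirror image: only the second sum changes, and its exponents decrease
        with the letter.\<close>
      have "{j. j \<in> {1..n} \<and> ?q j < j} = {j. j \<in> {1..n} \<and> p j < j}"
        using False by (auto simp: move_home_def dest: between split: if_splits)
      moreover have "(\<Sum>j | j \<in> {1..n} \<and> j < ?q j. 2 ^ (n + 1 - j)) < (\<Sum>j | j \<in> {1..n} \<and> j < p j. (2::nat) ^ (n + 1 - j))"
        by (rule sum_power2_less[where a = m])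
          (use False nonfix m in \<open>auto simp: inj_on_def move_home_def dest: between split: if_splits\<close>)
      ultimately show ?thesis
        by (simp add: tie_breaker_def)
    qed
    ultimately show ?thesis
      by (simp add: potential_def)
  qed
qed

section \<open>Permutations that agree on the order of nonfixed letters\<close>

definition nonfixed :: "nat \<Rightarrow> (nat \<Rightarrow> nat) \<Rightarrow> nat set" where
  "nonfixed n p = {j \<in> {1..n}. p j \<noteq> j}"

lemma card_atMost_inject:
  fixes R :: "nat set"
  assumes "finite R" "a \<in> R" "b \<in> R" "card {k \<in> R. k \<le> a} = card {k \<in> R. k \<le> b}"
  shows "a = b"
proof -
  have sub: "{k \<in> R. k \<le> a} \<subseteq> {k \<in> R. k \<le> b} \<or> {k \<in> R. k \<le> b} \<subseteq> {k \<in> R. k \<le> a}"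
    by auto
  have fin: "finite {k \<in> R. k \<le> c}" for c
    using assms(1) by simp
  have "{k \<in> R. k \<le> a} = {k \<in> R. k \<le> b}"
    using sub card_subset_eq[OF fin _ assms(4)] card_subset_eq[OF fin _ assms(4)[symmetric]] by blast
  then show ?thesis using assms(2,3) by (auto intro: antisym)
qed

text \<open>The order on \<open>R\<close> determines the rank of every value, and a member of a
  finite set of numbers is determined by its rank.\<close>

lemma permutes_eq_if_same_order:
  assumes p: "p permutes R" and q: "q permutes R" and fin: "finite R"
    and ord: "\<And>i j. i \<in> R \<Longrightarrow> j \<in> R \<Longrightarrow> q i \<le> q j \<longleftrightarrow> p i \<le> (p j :: nat)"
  shows "q = p"
proof
  fix j
  have rank: "card {k \<in> R. k \<le> r j} = card {i \<in> R. r i \<le> r j}" if r: "r permutes R" for r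
  proof -
    have "{k \<in> R. k \<le> r j} = r ` {i \<in> R. r i \<le> r j}"
      using permutes_image[OF r] by auto
    then show ?thesis
      by (simp add: card_image inj_on_subset[OF permutes_inj[OF r]])
  qed
  show "q j = p j"
  proof (cases "j \<in> R")
    case True
    have "card {k \<in> R. k \<le> q j} = card {k \<in> R. k \<le> p j}"
      unfolding rank[OF p] rank[OF q] using ord True by (intro arg_cong[where f = card]) auto
    then show ?thesis
      using card_atMost_inject fin True permutes_in_image[OF p] permutes_in_image[OF q] by blast
  qed (use p q in \<open>simp add: permutes_not_in\<close>)
qed

text \<open>While \<open>q\<close> differs from \<open>p\<close>, some letter fixed by
  \<open>p\<close> is not at home in \<open>q\<close>. Moving it home lowers the potential and keeps
  the order of the letters not fixed by \<open>p\<close>, so the descent ends at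
  \<open>p\<close>.\<close>

lemma potential_less_if_same_order_nonfixed:
  assumes p: "p permutes {1..n}" and q: "q permutes {1..n}" and neq: "q \<noteq> p"
    and ord: "\<And>i j. i \<in> nonfixed n p \<Longrightarrow> j \<in> nonfixed n p \<Longrightarrow> q i \<le> q j \<longleftrightarrow> p i \<le> p j"
  shows "potential n p < potential n q"
  using q neq ord
proof (induction "potential n q" arbitrary: q rule: less_induct)
  case less
  \<comment> \<open>Otherwise every letter displaced by \<open>q\<close> is displaced by
    \<open>p\<close> too, so both permute \<open>nonfixed n p\<close>, in the same order, and
    coincide.\<close>
  have "\<exists>m\<in>{1..n}. p m = m \<and> q m \<noteq> m"
  proof (rule ccontr)
    assume none: "\<not> ?thesis"
    have "p permutes nonfixed n p" "q permutes nonfixed n p" "finite (nonfixed n p)"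
      using none by (auto simp: nonfixed_def intro!: permutes_superset[OF p] permutes_superset[OF less.prems(1)])
    then have "q = p"
      using less.prems(3) by (rule permutes_eq_if_same_order)
    with less.prems(2) show False ..
  qed
  then obtain m where m: "m \<in> {1..n}" "p m = m" "q m \<noteq> m"
    by blast
  let ?q = "move_home q m"
  have down: "potential n ?q < potential n q"
    using potential_move_home_less less.prems(1) m by blast
  have "potential n p < potential n ?q" if "?q \<noteq> p"
  proof (rule less.hyps[OF down _ that])
    show "?q permutes {1..n}"
      using move_home_permutes less.prems(1) m by blast
    fix i j assume ij: "i \<in> nonfixed n p" "j \<in> nonfixed n p"
    then have "i \<noteq> m" "j \<noteq> m"
      using m by (auto simp: nonfixed_def)
    then show "?q i \<le> ?q j \<longleftrightarrow> p i \<le> p j"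
      using less.prems(3)[OF ij] move_home_le_iff[OF permutes_inj[OF less.prems(1)]] by simp
  qed
  with down show ?case
    by (cases "?q = p") auto
qed

section \<open>Attaching facets\<close>

text \<open>\<open>S\<close> stays put while \<open>T\<close> is deformed into it. \<open>H\<close>
  is stationary on the overlap of the two closed sets, so the pieces paste, and \<open>S\<close> is
  a deformation retract of the union.\<close>

lemma contractible_space_Un_deformation:
  fixes S T :: "'a::topological_space set" and H :: "real \<times> 'a \<Rightarrow> 'a"
  assumes closed: "closed S" "closed T" and S: "contractible_space (top_of_set S)"
    and cont: "continuous_on ({0..1} \<times> T) H"
    and into: "\<And>t x. t \<in> {0..1} \<Longrightarrow> x \<in> T \<Longrightarrow> H (t, x) \<in> T"
    and start: "\<And>x. x \<in> T \<Longrightarrow> H (0, x) = x"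
    and finish: "\<And>x. x \<in> T \<Longrightarrow> H (1, x) \<in> S"
    and rel: "\<And>t x. t \<in> {0..1} \<Longrightarrow> x \<in> S \<inter> T \<Longrightarrow> H (t, x) = x"
  shows "contractible_space (top_of_set (S \<union> T))"
proof -
  define K where "K = (\<lambda>z :: real \<times> 'a. if snd z \<in> S then snd z else H z)"
  have "continuous_on ({0..1} \<times> S \<union> {0..1} \<times> T) K"
    unfolding K_def using rel
    by (intro continuous_on_cases closed_Times closed closed_real_atLeastAtMost cont continuous_intros) auto
  then have K: "continuous_on ({0..1} \<times> (S \<union> T)) K"
    by (simp add: Sigma_Un_distrib2)
  have K_into: "K ` ({0..1} \<times> (S \<union> T)) \<subseteq> S \<union> T"
    using into by (auto simp: K_def)
  define r where "r x = K (1, x)" for x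
  have r: "continuous_on (S \<union> T) r"
    unfolding r_def by (intro continuous_on_compose2[OF K] continuous_intros) auto
  have "homotopic_with (\<lambda>x. True) (top_of_set (S \<union> T)) (top_of_set (S \<union> T)) id r"
    unfolding homotopic_with[of _ "\<lambda>x. True", simplified]
    using K K_into start by (intro exI[of _ K]) (auto simp: K_def r_def into)
  \<comment> \<open>Up to homotopy the identity of the union factors through \<open>S\<close>, so
    contractibility passes from \<open>S\<close> to the union.\<close>
  then have "homotopic_with (\<lambda>x. True) (top_of_set (S \<union> T)) (top_of_set (S \<union> T)) (id \<circ> r) id"
    by (simp add: homotopic_with_symD)
  moreover have "continuous_map (top_of_set S) (top_of_set (S \<union> T)) id"
    by auto
  moreover have "continuous_map (top_of_set (S \<union> T)) (top_of_set S) r"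
    using r finish by (auto simp: r_def K_def)
  ultimately show ?thesis
    using homotopy_dominated_contractibility S by blast
qed

lemma continuous_on_Min_image:
  fixes f :: "'a::topological_space \<Rightarrow> 'b \<Rightarrow> real"
  assumes "finite R" "R \<noteq> {}" "\<And>i. i \<in> R \<Longrightarrow> continuous_on S (\<lambda>x. f x i)"
  shows "continuous_on S (\<lambda>x. Min (f x ` R))"
  using assms by (induction rule: finite_ne_induct) (auto intro: continuous_on_min)

section \<open>Weight vectors and facets in a product of real lines\<close>

definition letter_simplex :: "nat \<Rightarrow> (nat \<Rightarrow> real) set" where
  "letter_simplex n = {T. (\<forall>i. 0 \<le> T i) \<and> (\<forall>i. i \<notin> {1..n} \<longrightarrow> T i = 0) \<and> (\<Sum>i=1..n. T i) = 1}"

lemma letter_simplexD: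
  assumes "T \<in> letter_simplex n"
  shows "0 \<le> T i" "i \<notin> {1..n} \<Longrightarrow> T i = 0" "(\<Sum>i=1..n. T i) = 1"
  using assms by (auto simp: letter_simplex_def)

lemma letter_simplex_le_1:
  assumes T: "T \<in> letter_simplex n"
  shows "T i \<le> 1"
proof (cases "i \<in> {1..n}")
  case True
  then have "T i \<le> (\<Sum>i=1..n. T i)"
    using letter_simplexD(1)[OF T] by (intro member_le_sum) auto
  then show ?thesis using letter_simplexD(3)[OF T] by simp
qed (use letter_simplexD(2)[OF T] in simp)

lemma compact_letter_simplex: "compact (letter_simplex n)"
proof -
  have coord: "continuous_on UNIV (\<lambda>T :: nat \<Rightarrow> real. T i)" for i
    by (rule continuous_on_product_coordinates)
  have "compact (PiE UNIV (\<lambda>_ :: nat. {0..1 :: real}))"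
    unfolding compactin_euclidean_iff[symmetric] euclidean_product_topology[symmetric]
    by (simp add: compactin_PiE)
  moreover have "closed (letter_simplex n)"
    unfolding letter_simplex_def
    by (intro closed_Collect_conj closed_Collect_all closed_Collect_le closed_Collect_eq closed_Collect_imp
        continuous_on_const continuous_on_sum coord) simp
  moreover have "letter_simplex n \<subseteq> PiE UNIV (\<lambda>_. {0..1})"
    using letter_simplexD(1) letter_simplex_le_1 by (auto simp: PiE_def)
  ultimately show ?thesis
    by (metis compact_Int_closed inf.absorb_iff2)
qed

text \<open>
  A point of the complex is a weight vector \<open>T\<close> on the letters together with an ordering of
  its support. The entry at \<open>(i, j)\<close> records whether \<open>i\<close> precedes \<open>j\<close>, and it fades out
  continuously as either weight tends to zero; the diagonal entries recover \<open>T\<close>.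
\<close>

definition order_point :: "(nat \<Rightarrow> nat) \<Rightarrow> (nat \<Rightarrow> real) \<Rightarrow> nat \<times> nat \<Rightarrow> real" where
  "order_point p T = (\<lambda>(i, j). if p i \<le> p j then min (T i) (T j) else 0)"

lemma order_point_diag [simp]: "order_point p T (i, i) = T i"
  by (simp add: order_point_def)

text \<open>Between letters of positive weight the entries record the order; an entry with a
  vanishing weight is zero either way, by nonnegativity. So two facets share a point exactly if they
  order its support alike.\<close>

lemma order_point_eq_iff:
  assumes "\<And>i. 0 \<le> T i"
  shows "order_point p T = order_point q T' \<longleftrightarrow>
    T = T' \<and> (\<forall>i j. T i \<noteq> 0 \<longrightarrow> T j \<noteq> 0 \<longrightarrow> (p i \<le> p j \<longleftrightarrow> q i \<le> q j))"
proof
  assume eq: "order_point p T = order_point q T'"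
  then have T: "T = T'"
    by (metis order_point_diag ext)
  have "p i \<le> p j \<longleftrightarrow> q i \<le> q j" if "T i \<noteq> 0" "T j \<noteq> 0" for i j
    using fun_cong[OF eq, of "(i, j)"] that by (auto simp: order_point_def T min_def split: if_splits)
  with T show "T = T' \<and> (\<forall>i j. T i \<noteq> 0 \<longrightarrow> T j \<noteq> 0 \<longrightarrow> (p i \<le> p j \<longleftrightarrow> q i \<le> q j))"
    by blast
next
  assume R: "T = T' \<and> (\<forall>i j. T i \<noteq> 0 \<longrightarrow> T j \<noteq> 0 \<longrightarrow> (p i \<le> p j \<longleftrightarrow> q i \<le> q j))"
  have "order_point p T (i, j) = order_point q T' (i, j)" for i j
    using R assms[of i] assms[of j]
    by (cases "T i = 0 \<or> T j = 0") (auto simp: order_point_def min_def)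
  then show "order_point p T = order_point q T'"
    by auto
qed

lemma continuous_on_order_point:
  assumes "continuous_on S f"
  shows "continuous_on S (\<lambda>x. order_point p (f x))"
proof (rule continuous_on_coordinatewise_then_product)
  fix ij
  have "continuous_on S (\<lambda>x. f x i)" for i
    using assms by (rule continuous_on_product_then_coordinatewise)
  then show "continuous_on S (\<lambda>x. order_point p (f x) ij)"
    by (cases ij; cases "p (fst ij) \<le> p (snd ij)")
      (auto simp: order_point_def intro!: continuous_on_min)
qed

text \<open>A copy of the top simplex of the word with position function \<open>p\<close>; the
  parametrization is injective because the diagonal recovers the weights.\<close>

definition facet :: "nat \<Rightarrow> (nat \<Rightarrow> nat) \<Rightarrow> (nat \<times> nat \<Rightarrow> real) set" where
  "facet n p = order_point p ` letter_simplex n"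

lemma closed_facet: "closed (facet n p)"
  unfolding facet_def
  by (intro compact_imp_closed compact_continuous_image compact_letter_simplex
      continuous_on_order_point continuous_on_id)

lemma continuous_on_snd_coordinate: "continuous_on A (\<lambda>z. snd z i)"
  by (rule continuous_on_product_then_coordinatewise) (rule continuous_on_snd[OF continuous_on_id])

text \<open>Reading the weights off the diagonal inverts \<open>order_point p\<close> continuously,
  so a homotopy of weight vectors carries over to the facet.\<close>

lemma continuous_on_facet_homotopy:
  assumes "\<And>i. continuous_on ({0..1} \<times> UNIV) (\<lambda>(t :: real, T). h t T i)"
  shows "continuous_on ({0..1} \<times> facet n p) (\<lambda>(t, x). order_point p (h t (\<lambda>i. x (i, i))))"
proof -
  have "continuous_on ({0..1} \<times> facet n p) (\<lambda>z :: real \<times> (nat \<times> nat \<Rightarrow> real). (fst z, \<lambda>i. snd z (i, i)))"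
    by (intro continuous_on_Pair continuous_on_fst continuous_on_id
        continuous_on_coordinatewise_then_product continuous_on_snd_coordinate)
  then have "continuous_on ({0..1} \<times> facet n p) (\<lambda>z. h (fst z) (\<lambda>i. snd z (i, i)) i)" for i
    using continuous_on_compose2[OF assms[of i]] by (force simp: case_prod_beta)
  then have "continuous_on ({0..1} \<times> facet n p) (\<lambda>z. h (fst z) (\<lambda>i. snd z (i, i)))"
    by (rule continuous_on_coordinatewise_then_product)
  then show ?thesis
    unfolding case_prod_beta by (rule continuous_on_order_point)
qed

text \<open>The straight-line contraction to the vertex of the letter \<open>1\<close>, seen as
  gluing the facet to that single point.\<close>

lemma contractible_space_facet:
  assumes "n \<ge> 1"
  shows "contractible_space (top_of_set (facet n p))"
proof -
  define v :: "nat \<Rightarrow> real" where "v i = (if i = 1 then 1 else 0)" for i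
  define h where "h t T i = (1 - t) * T i + t * v i" for t T i
  have v: "v \<in> letter_simplex n"
    using assms by (auto simp: letter_simplex_def v_def)
  have h: "h t T \<in> letter_simplex n" if "t \<in> {0..1}" "T \<in> letter_simplex n" for t T
    using that v by (auto simp: letter_simplex_def h_def sum.distrib sum_distrib_left[symmetric])
  have "contractible_space (top_of_set ({order_point p v} \<union> facet n p))"
  proof (rule contractible_space_Un_deformation[where H = "\<lambda>(t, x). order_point p (h t (\<lambda>i. x (i, i)))"])
    show "continuous_on ({0..1} \<times> facet n p) (\<lambda>(t, x). order_point p (h t (\<lambda>i. x (i, i))))"
      unfolding h_def case_prod_beta
      by (intro continuous_on_facet_homotopy[unfolded case_prod_beta] continuous_intros
          continuous_on_snd_coordinate)
    have "h t v = v" "h 0 T = T" "h 1 T = v" for t T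
      by (auto simp: h_def algebra_simps)
    note ends = this
    show "(\<lambda>(t, x). order_point p (h t (\<lambda>i. x (i, i)))) (t, x) \<in> facet n p"
      if "t \<in> {0..1}" "x \<in> facet n p" for t x
      using h that by (auto simp: facet_def)
    show "(\<lambda>(t, x). order_point p (h t (\<lambda>i. x (i, i)))) (0, x) = x" if "x \<in> facet n p" for x
      using that ends by (auto simp: facet_def)
    show "(\<lambda>(t, x). order_point p (h t (\<lambda>i. x (i, i)))) (t, x) = x"
      if "x \<in> {order_point p v} \<inter> facet n p" for t x
      using that ends by auto
    show "(\<lambda>(t, x). order_point p (h t (\<lambda>i. x (i, i)))) (1, x) \<in> {order_point p v}" for x
      using ends by simp
  qed (auto simp: closed_facet)
  moreover have "{order_point p v} \<union> facet n p = facet n p"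
    using v by (auto simp: facet_def)
  ultimately show ?thesis
    by simp
qed

text \<open>By \<open>meet\<close>, the facet meets \<open>S\<close> in the faces opposite to
  nonfixed letters. Lowering the weights of all nonfixed letters at the same rate, in favour of the
  fixed letter \<open>a\<close>, ends on one of these faces and fixes each of them
  pointwise.\<close>

lemma contractible_space_attach_facet:
  assumes a: "a \<in> {1..n}" "p a = a" and R: "nonfixed n p \<noteq> {}"
    and S: "closed S" "contractible_space (top_of_set S)"
    and meet: "\<And>T. T \<in> letter_simplex n \<Longrightarrow>
      order_point p T \<in> S \<longleftrightarrow> (\<exists>m\<in>nonfixed n p. T m = 0)"
  shows "contractible_space (top_of_set (S \<union> facet n p))"
proof -
  define R where "R = nonfixed n p"
  have fin: "finite R" "R \<noteq> {}" "a \<notin> R" "R \<subseteq> {1..n}"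
    using assms by (auto simp: R_def nonfixed_def)
  \<comment> \<open>\<open>s T\<close> is the most that all nonfixed letters can give up at once; on
    the simplex it vanishes exactly on the faces shared with \<open>S\<close>. The factor
    \<open>card R\<close> in \<open>h\<close> keeps the total weight at 1.\<close>
  define s where "s T = Min (T ` R)" for T :: "nat \<Rightarrow> real"
  define h where "h t T i = T i + (if i = a then t * card R * s T else 0) - (if i \<in> R then t * s T else 0)"
    for t :: real and T i
  txt \<open>
    The homotopy \<open>h\<close> moves the weight common to all nonfixed letters onto the fixed letter \<open>a\<close>.
  \<close>
  have s_le: "s T \<le> T i" if "i \<in> R" for T i
    using that fin by (simp add: s_def)
  have s_attained: "\<exists>m\<in>R. s T = T m" for T
    using Min_in[of "T ` R"] fin unfolding s_def by blast
  have s_nonneg: "0 \<le> s T" if "T \<in> letter_simplex n" for T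
    using s_attained[of T] letter_simplexD(1)[OF that] by force
  have s_0: "s T = 0 \<longleftrightarrow> (\<exists>m\<in>R. T m = 0)" if "T \<in> letter_simplex n" for T
    using s_attained[of T] s_nonneg[OF that] s_le[of _ T] by force
  have h: "h t T \<in> letter_simplex n" if t: "t \<in> {0..1}" and T: "T \<in> letter_simplex n" for t T
    unfolding letter_simplex_def
  proof (intro CollectI conjI allI impI)
    fix i
    have "t * s T \<le> 1 * s T"
      using t s_nonneg[OF T] by (intro mult_right_mono) auto
    then show "0 \<le> h t T i"
      using t s_nonneg[OF T] letter_simplexD(1)[OF T, of i] s_le[of i T] fin by (auto simp: h_def)
    show "h t T i = 0" if "i \<notin> {1..n}"
      using that a fin letter_simplexD(2)[OF T] by (auto simp: h_def)
  next
    have "(\<Sum>i=1..n. if i \<in> R then t * s T else 0) = card R * (t * s T)"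
      using fin by (simp add: sum.If_cases inf.absorb2)
    then show "(\<Sum>i=1..n. h t T i) = 1"
      using a letter_simplexD(3)[OF T] by (simp add: h_def sum.distrib sum_subtractf)
  qed
  show ?thesis
  proof (rule contractible_space_Un_deformation[where H = "\<lambda>(t, x). order_point p (h t (\<lambda>i. x (i, i)))"])
    have "continuous_on A (\<lambda>z. s (snd z))" for A :: "(real \<times> (nat \<Rightarrow> real)) set"
      unfolding s_def using fin by (intro continuous_on_Min_image continuous_on_snd_coordinate)
    then have "continuous_on ({0..1} \<times> UNIV) (\<lambda>(t, T). h t T i)" for i
      unfolding h_def case_prod_beta
      by (cases "i = a"; cases "i \<in> R") (auto intro!: continuous_intros continuous_on_snd_coordinate)
    then show "continuous_on ({0..1} \<times> facet n p) (\<lambda>(t, x). order_point p (h t (\<lambda>i. x (i, i))))"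
      by (rule continuous_on_facet_homotopy)
    show "(\<lambda>(t, x). order_point p (h t (\<lambda>i. x (i, i)))) (t, x) \<in> facet n p"
      if "t \<in> {0..1}" "x \<in> facet n p" for t x
      using h that by (auto simp: facet_def)
    have "h 0 T = T" for T
      by (auto simp: h_def)
    then show "(\<lambda>(t, x). order_point p (h t (\<lambda>i. x (i, i)))) (0, x) = x" if "x \<in> facet n p" for x
      using that by (auto simp: facet_def)
    show "(\<lambda>(t, x). order_point p (h t (\<lambda>i. x (i, i)))) (1, x) \<in> S" if "x \<in> facet n p" for x
    proof -
      obtain T where T: "T \<in> letter_simplex n" "x = order_point p T"
        using \<open>x \<in> facet n p\<close> by (auto simp: facet_def)
      obtain m where "m \<in> R" "s T = T m"
        using s_attained by blast
      then have "h 1 T m = 0"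
        using fin by (auto simp: h_def)
      then show ?thesis
        using meet[OF h[of 1 T]] T \<open>m \<in> R\<close> by (auto simp: R_def)
    qed
    show "(\<lambda>(t, x). order_point p (h t (\<lambda>i. x (i, i)))) (t, x) = x" if x: "x \<in> S \<inter> facet n p" for t x
    proof -
      obtain T where T: "T \<in> letter_simplex n" "x = order_point p T"
        using x by (auto simp: facet_def)
      then have "s T = 0"
        using meet[OF T(1)] s_0 x by (auto simp: R_def)
      then have "h t T = T"
        by (auto simp: h_def)
      then show ?thesis
        using T by simp
    qed
  qed (use S in \<open>auto simp: closed_facet\<close>)
qed

section \<open>Induction along the potential\<close>

definition fixing_perms :: "nat \<Rightarrow> (nat \<Rightarrow> nat) set" where
  "fixing_perms n = {p. p permutes {1..n} \<and> (\<exists>a\<in>{1..n}. p a = a)}"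

lemma finite_fixing_perms: "finite (fixing_perms n)"
  unfolding fixing_perms_def by (rule finite_subset[OF _ finite_permutations[of "{1..n}"]]) auto

text \<open>The third hypothesis makes \<open>A\<close> closed downwards for the potential. Removing
  an element of maximal potential preserves this, ties included, as only strictly smaller potentials
  count; so the last facet can be split off.\<close>

lemma contractible_space_facets:
  assumes "A \<subseteq> fixing_perms n" "A \<noteq> {}"
    and "\<And>p q. p \<in> A \<Longrightarrow> q \<in> fixing_perms n \<Longrightarrow> potential n q < potential n p \<Longrightarrow> q \<in> A"
  shows "contractible_space (top_of_set (\<Union>p\<in>A. facet n p))"
  using assms
proof (induction "card A" arbitrary: A)
  case 0
  then show ?case
    using finite_subset[OF _ finite_fixing_perms] by auto
next
  case (Suc k)
  have finA: "finite A"
    using Suc.prems(1) finite_fixing_perms finite_subset by blast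
  obtain p where p: "p \<in> A" and max: "\<And>q. q \<in> A \<Longrightarrow> potential n q \<le> potential n p"
    using obtains_MAX[OF finA Suc.prems(2), of "potential n"] Max_ge[OF finite_imageI[OF finA]]
    by (metis imageI)
  obtain a where perm: "p permutes {1..n}" and a: "a \<in> {1..n}" "p a = a"
    using p Suc.prems(1) by (auto simp: fixing_perms_def)
  define B where "B = A - {p}"
  have A: "(\<Union>q\<in>A. facet n q) = (\<Union>q\<in>B. facet n q) \<union> facet n p"
    using p by (auto simp: B_def)
  show ?case
  proof (cases "B = {}")
    case True
    then show ?thesis
      using A a contractible_space_facet[of n p] by simp
  next
    case False
    \<comment> \<open>By the descent argument such a \<open>q\<close> would have a larger potential
      than the maximal \<open>p\<close>.\<close>
    have later: "False" if q: "q \<in> B"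
      and ord: "\<And>i j. i \<in> nonfixed n p \<Longrightarrow> j \<in> nonfixed n p \<Longrightarrow> q i \<le> q j \<longleftrightarrow> p i \<le> p j" for q
    proof -
      have "q permutes {1..n}" "q \<noteq> p" "q \<in> A"
        using q Suc.prems(1) by (auto simp: B_def fixing_perms_def)
      then show False
        using potential_less_if_same_order_nonfixed[OF perm _ _ ord] max by fastforce
    qed
    have "contractible_space (top_of_set (\<Union>q\<in>B. facet n q))"
    proof (rule Suc.hyps(1))
      show "k = card B"
        using Suc.hyps(2) p finA by (simp add: B_def)
      fix q r assume "q \<in> B" "r \<in> fixing_perms n" "potential n r < potential n q"
      then show "r \<in> B"
        using Suc.prems(3)[of q r] max[of q] by (auto simp: B_def)
    qed (use False Suc.prems(1) in \<open>auto simp: B_def\<close>)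
    moreover have "closed (\<Union>q\<in>B. facet n q)"
      using finA by (simp add: B_def closed_facet closed_UN)
    \<comment> \<open>If \<open>p\<close> had no nonfixed letter, every element of \<open>B\<close>
      would satisfy the order condition vacuously.\<close>
    moreover have "nonfixed n p \<noteq> {}"
      using later False by blast
    moreover have "order_point p T \<in> (\<Union>q\<in>B. facet n q) \<longleftrightarrow> (\<exists>m\<in>nonfixed n p. T m = 0)"
      if T: "T \<in> letter_simplex n" for T
    proof
      \<comment> \<open>A common point with positive weight on every nonfixed letter would make
        \<open>q\<close> order these letters as \<open>p\<close> does.\<close>
      assume "order_point p T \<in> (\<Union>q\<in>B. facet n q)"
      then obtain q T' where q: "q \<in> B" and eq: "order_point p T = order_point q T'"
        by (auto simp: facet_def)
      then show "\<exists>m\<in>nonfixed n p. T m = 0"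
        using later[OF q] letter_simplexD(1)[OF T] by (auto simp: order_point_eq_iff)
    next
      assume "\<exists>m\<in>nonfixed n p. T m = 0"
      then obtain m where m: "m \<in> {1..n}" "p m \<noteq> m" "T m = 0"
        by (auto simp: nonfixed_def)
      let ?q = "move_home p m"
      have less: "potential n ?q < potential n p"
        by (rule potential_move_home_less[OF perm m(1,2)])
      have "?q \<in> fixing_perms n"
        using move_home_permutes[OF perm m(1)] m(1) by (auto simp: fixing_perms_def intro!: bexI[of _ m])
      then have "?q \<in> B"
        using Suc.prems(3)[OF p _ less] less by (auto simp: B_def)
      \<comment> \<open>Only \<open>m\<close> changes its place relative to the other letters, and
        it carries no weight.\<close>
      moreover have "order_point p T = order_point ?q T"
        using letter_simplexD(1)[OF T] m(3) permutes_inj[OF perm]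
        by (subst order_point_eq_iff) (metis move_home_le_iff)+
      ultimately show "order_point p T \<in> (\<Union>q\<in>B. facet n q)"
        using T by (auto simp: facet_def)
    qed
    ultimately show ?thesis
      unfolding A using contractible_space_attach_facet[where p = p, OF a] by blast
  qed
qed

section \<open>Embedding the realization\<close>

lemma continuous_map_from_sum_topology:
  assumes "\<And>i. i \<in> I \<Longrightarrow> continuous_map (X i) Y (\<lambda>x. f (i, x))"
  shows "continuous_map (sum_topology X I) Y f"
  unfolding continuous_map_def
proof (intro conjI allI impI)
  show "f \<in> topspace (sum_topology X I) \<rightarrow> topspace Y"
    using assms by (force simp: continuous_map_def)
  fix U assume U: "openin Y U"
  have "openin (X i) {x. (i, x) \<in> {z \<in> topspace (sum_topology X I). f z \<in> U}}" if "i \<in> I" for i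
    using openin_continuous_map_preimage[OF assms[OF that] U] that by simp
  then show "openin (sum_topology X I) {z \<in> topspace (sum_topology X I). f z \<in> U}"
    by (auto simp: openin_sum_topology)
qed

lemma compact_space_sum_topology:
  assumes "finite I" "\<And>i. i \<in> I \<Longrightarrow> compact_space (X i)"
  shows "compact_space (sum_topology X I)"
proof -
  have "compactin (sum_topology X I) (\<Union>i\<in>I. Pair i ` topspace (X i))"
    using assms by (intro compactin_Union)
      (auto intro!: image_compactin continuous_map_component_injection simp: compact_space_def)
  moreover have "(\<Union>i\<in>I. Pair i ` topspace (X i)) = topspace (sum_topology X I)"
    by auto
  ultimately show ?thesis
    by (simp add: compact_space_def)
qed

text \<open>Finitely many simplices make the realization compact; \<open>F\<close> descends to a
  continuous injection into a Hausdorff space, which is then a homeomorphism onto its image.\<close>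

lemma geometric_realization_homeomorphic_image:
  fixes F :: "(nat \<times> 'a) \<times> (nat \<Rightarrow> real) \<Rightarrow> 'b::t2_space"
  assumes fin: "finite (Sigma UNIV K)"
    and cont: "\<And>p x. x \<in> K p \<Longrightarrow> continuous_on (standard_simplex p) (\<lambda>t. F ((p, x), t))"
    and resp: "\<And>z z'. face_identification K d z z' \<Longrightarrow> F z = F z'"
    and inj: "\<And>p x t q y s. \<lbrakk>x \<in> K p; t \<in> standard_simplex p; y \<in> K q; s \<in> standard_simplex q;
      F ((p, x), t) = F ((q, y), s)\<rbrakk> \<Longrightarrow> equivclp (face_identification K d) ((p, x), t) ((q, y), s)"
  shows "geometric_realization K d homeomorphic_space
    top_of_set (F ` (SIGMA px:Sigma UNIV K. standard_simplex (fst px)))"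
proof -
  let ?R = "face_identification K d"
  let ?q = "\<lambda>z. {z'. equivclp ?R z z'}"
  let ?\<Delta> = "\<lambda>(p, x). top_of_set (standard_simplex p)"
  define X where "X = sum_topology ?\<Delta> (Sigma UNIV K)"
  define Z where "Z = (SIGMA px:Sigma UNIV K. standard_simplex (fst px))"
  have real: "geometric_realization K d = quotient_topology X ?q"
    by (simp add: geometric_realization_def X_def euclidean_product_topology)
  have topX: "topspace X = Z"
    by (auto simp: X_def Z_def)
  have compact: "compact (standard_simplex p)" for p
    using compactin_standard_simplex[of p] by (simp add: euclidean_product_topology)
  have class_eq: "?q z = ?q z' \<longleftrightarrow> equivclp ?R z z'" for z z'
    by (auto intro: equivclp_sym equivclp_trans)
  have F_equiv: "F z = F z'" if "equivclp ?R z z'" for z z'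
    using that by (induction rule: equivclp_induct) (auto dest: resp)
  have "compact_space X"
    unfolding X_def using fin compact by (intro compact_space_sum_topology) (auto simp: compact_space_subtopology)
  then have "compact_space (quotient_topology X ?q)"
    using image_compactin[OF _ quotient_imp_continuous_map[OF quotient_map_quotient_topology]]
    unfolding compact_space_def by force
  moreover have contF: "continuous_map X (top_of_set (F ` Z)) F"
    unfolding X_def
    by (rule continuous_map_from_sum_topology) (auto simp: Z_def intro!: cont imageI)
  have "F z = F z'" if "?q z = ?q z'" for z z'
    using that F_equiv class_eq by simp
  with quotient_map_lift_exists[OF quotient_map_quotient_topology contF, of ?q]
  obtain g where g: "continuous_map (quotient_topology X ?q) (top_of_set (F ` Z)) g"
    and img: "g ` topspace (quotient_topology X ?q) = F ` topspace X"
    and gF: "\<And>z. z \<in> topspace X \<Longrightarrow> g (?q z) = F z"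
    by blast
  moreover have "inj_on g (topspace (quotient_topology X ?q))"
  proof (rule inj_onI)
    fix c c' assume c: "c \<in> topspace (quotient_topology X ?q)" "c' \<in> topspace (quotient_topology X ?q)"
      and eq: "g c = g c'"
    obtain z z' where z: "z \<in> Z" "z' \<in> Z" "c = ?q z" "c' = ?q z'"
      using c by (auto simp: topX)
    then have "F z = F z'"
      using gF eq by (simp add: topX)
    then have "equivclp ?R z z'"
      using z by (auto simp: Z_def intro: inj)
    then show "c = c'"
      using z class_eq by simp
  qed
  moreover have "Hausdorff_space (top_of_set (F ` Z))"
    by (intro Hausdorff_space_subtopology) (auto simp: Hausdorff_space_def disjnt_def dest!: hausdorff)
  ultimately have "homeomorphic_map (quotient_topology X ?q) (top_of_set (F ` Z)) g"
    by (intro continuous_imp_homeomorphic_map) (auto simp: topX)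
  then show ?thesis
    unfolding real Z_def by (rule homeomorphic_map_imp_homeomorphic_space)
qed

section \<open>Positions and weights of letters in a word\<close>

definition position :: "'a list \<Rightarrow> 'a \<Rightarrow> nat" where
  "position w i = length (takeWhile (\<lambda>x. x \<noteq> i) w)"

lemma position_Cons: "position (x # w) i = (if x = i then 0 else Suc (position w i))"
  by (simp add: position_def)

lemma position_nth: "distinct w \<Longrightarrow> k < length w \<Longrightarrow> position w (w ! k) = k"
  by (induction w arbitrary: k) (auto simp: position_Cons nth_Cons split: nat.splits)

lemma position_subseq_le_iff:
  assumes "subseq v w" "distinct w" "i \<in> set v" "j \<in> set v"
  shows "position v i \<le> position v j \<longleftrightarrow> position w i \<le> position w j"
  using assms
proof (induction rule: list_emb.induct)
  case (list_emb_Cons v w y)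
  \<comment> \<open>The skipped letter \<open>y\<close> does not recur in \<open>w\<close>, so it
    differs from \<open>i\<close> and \<open>j\<close> and shifts both positions in the longer word
    by one.\<close>
  then have "i \<noteq> y" "j \<noteq> y"
    using list_emb_set[of "(=)" v w] by auto
  with list_emb_Cons show ?case
    by (simp add: position_Cons)
qed (auto simp: position_Cons)

text \<open>Both words list the same letters in increasing order of \<open>position w\<close>, and
  such a list is unique.\<close>

lemma eq_if_same_position_order:
  assumes w: "distinct w" and v: "distinct v" and set: "set w = set v"
    and ord: "\<And>i j. i \<in> set v \<Longrightarrow> j \<in> set v \<Longrightarrow> position w i \<le> position w j \<longleftrightarrow> position v i \<le> position v j"
  shows "w = v"
proof -
  have inj: "inj_on (position w) (set w)"
    using position_nth[OF w] by (auto simp: inj_on_def in_set_conv_nth)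
  have "sorted (map (position w) w)"
    using position_nth[OF w] by (auto simp: sorted_iff_nth_mono)
  moreover have "sorted (map (position w) v)"
    using position_nth[OF v] ord by (auto simp: sorted_iff_nth_mono)
  ultimately have "map (position w) w = map (position w) v"
    using w v set inj by (intro sorted_distinct_set_unique) (auto simp: distinct_map)
  then show ?thesis
    using inj set by (metis Un_absorb map_inj_on)
qed

text \<open>Barycentric coordinates indexed by places are pushed forward to letters, which makes
  points on different words comparable.\<close>

definition letter_weight :: "nat list \<Rightarrow> (nat \<Rightarrow> real) \<Rightarrow> nat \<Rightarrow> real" where
  "letter_weight w t i = (\<Sum>k<length w. if w ! k = i then t k else 0)"

lemma letter_weight_nth:
  assumes "distinct w" "k < length w"
  shows "letter_weight w t (w ! k) = t k"
proof -
  have "letter_weight w t (w ! k) = (\<Sum>l<length w. if l = k then t l else 0)"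
    unfolding letter_weight_def using assms by (intro sum.cong) (auto simp: nth_eq_iff_index_eq)
  then show ?thesis
    using assms by simp
qed

lemma letter_weight_notin: "i \<notin> set w \<Longrightarrow> letter_weight w t i = 0"
  unfolding letter_weight_def by (intro sum.neutral) auto

lemma letter_weight_nonneg: "(\<And>k. 0 \<le> t k) \<Longrightarrow> 0 \<le> letter_weight w t i"
  unfolding letter_weight_def by (intro sum_nonneg) auto

text \<open>The map on the disjoint simplices whose fibres are to be the classes of the
  realization.\<close>

definition word_point :: "(nat \<times> nat list) \<times> (nat \<Rightarrow> real) \<Rightarrow> nat \<times> nat \<Rightarrow> real" where
  "word_point = (\<lambda>((p, w), t). order_point (position w) (letter_weight w t))"

lemma continuous_on_word_point: "continuous_on S (\<lambda>t. word_point ((p, w), t))"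
proof -
  have "continuous_on S (\<lambda>t. if w ! k = i then t k else 0 :: real)" for k i
    by (cases "w ! k = i")
      (auto intro: continuous_on_product_then_coordinatewise[OF continuous_on_id, unfolded id_def])
  then have "continuous_on S (letter_weight w)"
    unfolding letter_weight_def
    by (intro continuous_on_coordinatewise_then_product continuous_on_sum)
  then show ?thesis
    by (auto simp: word_point_def intro: continuous_on_order_point)
qed

text \<open>Inserting a zero coordinate at \<open>i\<close> gives weight zero to the deleted letter;
  all other letters keep their weights.\<close>

lemma letter_weight_word_face:
  assumes w: "distinct w" "length w = Suc (Suc p)" and i: "i \<le> Suc p"
  shows "letter_weight (word_face (Suc p) i w) t = letter_weight w (simplical_face i t)"
proof
  fix c
  let ?v = "word_face (Suc p) i w"
  have v: "distinct ?v" "length ?v = Suc p"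
    using w i subseq_word_face[of "Suc p" i w] by (auto simp: word_face_def set_take_disj_set_drop_if_distinct)
  have v_nth: "?v ! k = w ! (if k < i then k else Suc k)" if "k < Suc p" for k
    using w(2) i that by (auto simp: word_face_def nth_append)
  show "letter_weight ?v t c = letter_weight w (simplical_face i t) c"
  proof (cases "c \<in> set w")
    case True
    then obtain k where k: "k < Suc (Suc p)" "c = w ! k"
      using w(2) by (auto simp: in_set_conv_nth)
    then have R: "letter_weight w (simplical_face i t) c = simplical_face i t k"
      using w by (simp add: letter_weight_nth)
    consider "k < i" | "k = i" | "k > i" by linarith
    then show ?thesis
    proof cases
      case 1
      then show ?thesis
        using R k i v v_nth[of k] letter_weight_nth[of ?v k t] by (simp add: simplical_face_def)
    next
      case 2
      have "c \<notin> set ?v"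
        using v v_nth w k 2 by (auto simp: in_set_conv_nth nth_eq_iff_index_eq split: if_splits)
      then show ?thesis
        using R 2 by (simp add: letter_weight_notin simplical_face_def)
    next
      case 3
      then obtain l where l: "k = Suc l" "i \<le> l"
        by (cases k) auto
      then show ?thesis
        using R k v v_nth[of l] letter_weight_nth[of ?v l t] by (simp add: simplical_face_def)
    qed
  next
    case False
    then have "c \<notin> set ?v"
      using list_emb_set[OF subseq_word_face] by blast
    with False show ?thesis
      by (simp add: letter_weight_notin)
  qed
qed

lemma word_simplicesD:
  assumes "w \<in> word_simplices n S p"
  shows "distinct w" "set w \<subseteq> {1..n}" "length w = Suc p" "\<exists>\<sigma>\<in>S. subseq w (perm_word n \<sigma>)"
  using assms by (auto simp: word_simplices_def generated_words_def injective_word_def)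

text \<open>Only letters of \<open>v\<close> carry weight, and \<open>v\<close> orders them as
  \<open>w\<close> does.\<close>

lemma order_point_subseq:
  assumes "subseq v w" "distinct w" "\<And>k. 0 \<le> t k"
  shows "order_point (position v) (letter_weight v t) = order_point (position w) (letter_weight v t)"
proof -
  have "position v i \<le> position v j \<longleftrightarrow> position w i \<le> position w j"
    if "letter_weight v t i \<noteq> 0" "letter_weight v t j \<noteq> 0" for i j
    using that letter_weight_notin by (intro position_subseq_le_iff[OF assms(1,2)]) blast+
  then show ?thesis
    using letter_weight_nonneg[OF assms(3)] by (simp add: order_point_eq_iff)
qed

lemma word_point_face_identification:
  assumes "face_identification (word_simplices n S) word_face z z'"
  shows "word_point z = word_point z'"
  using assms
proof cases
  case (1 x p i t)
  then show ?thesis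
    using word_simplicesD[OF 1(3)] order_point_subseq[OF subseq_word_face, of x t "Suc p" i]
    by (auto simp: word_point_def letter_weight_word_face standard_simplex_def)
qed

lemma standard_simplex_face:
  assumes t: "t \<in> standard_simplex (Suc p)" and k: "k \<le> Suc p" "t k = 0"
  obtains s where "s \<in> standard_simplex p" "t = simplical_face k s"
proof
  let ?s = "\<lambda>i. if i < k then t i else t (Suc i)"
  show "t = simplical_face k ?s"
  proof
    fix i show "t i = simplical_face k ?s i"
      using k by (cases i) (auto simp: simplical_face_def)
  qed
  have "(\<Sum>i\<le>p. ?s i) = (\<Sum>i\<in>{..Suc p} - {k}. t i)"
    by (rule sum.reindex_bij_witness[of _ "\<lambda>i. if i < k then i else i - 1" "\<lambda>i. if i < k then i else Suc i"])
      (use k in auto)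
  also have "\<dots> = (\<Sum>i\<le>Suc p. t i)"
    using k by (simp add: sum_diff1)
  finally show "?s \<in> standard_simplex p"
    using t k by (auto simp: standard_simplex_def)
qed

text \<open>Every point lies in the interior of some simplex: as long as a coordinate vanishes, pass
  to the face opposite to its vertex. In dimension 0 the only coordinate is 1.\<close>

lemma equivclp_positive_representative:
  assumes K: "semisimplicial_set K d" and x: "x \<in> K p" and t: "t \<in> standard_simplex p"
  obtains q y s where "y \<in> K q" "s \<in> standard_simplex q" "\<forall>k\<le>q. s k > 0"
    "equivclp (face_identification K d) ((p, x), t) ((q, y), s)"
  using x t
proof (induction p arbitrary: x t thesis)
  case 0
  have "\<forall>k\<le>0. t k > 0"
    using 0(3) by (simp add: standard_simplex_0)
  then show ?case
    by (rule 0(1)[OF 0(2,3)]) (rule equivclp_refl)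
next
  case (Suc p)
  show ?case
  proof (cases "\<exists>k\<le>Suc p. t k = 0")
    case True
    then obtain k where k: "k \<le> Suc p" "t k = 0" by blast
    obtain s where s: "s \<in> standard_simplex p" "t = simplical_face k s"
      using standard_simplex_face[OF Suc.prems(3) k] .
    have y: "d (Suc p) k x \<in> K p"
      using K Suc.prems(2) k by (simp add: semisimplicial_set_def)
    have "face_identification K d ((p, d (Suc p) k x), s) ((Suc p, x), t)"
      unfolding s(2) using Suc.prems(2) k(1) s(1) by (rule face_identification.intros)
    then have eq: "equivclp (face_identification K d) ((Suc p, x), t) ((p, d (Suc p) k x), s)"
      by (intro equivclp_sym[OF r_into_equivclp])
    show ?thesis
    proof (rule Suc.IH[OF _ y s(1)])
      fix q y r
      assume "y \<in> K q" "r \<in> standard_simplex q" "\<forall>k\<le>q. r k > 0"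
        and "equivclp (face_identification K d) ((p, d (Suc p) k x), s) ((q, y), r)"
      then show thesis
        by (intro Suc.prems(1)[of y q r] equivclp_trans[OF eq])
    qed
  next
    case False
    then have "\<forall>k\<le>Suc p. t k > 0"
      using Suc.prems(3) by (force simp: standard_simplex_def order_less_le)
    then show ?thesis
      by (rule Suc.prems(1)[OF Suc.prems(2,3)]) (rule equivclp_refl)
  qed
qed

text \<open>Positive weights make the support the letter set of the word; the order entries then
  determine the word, and the diagonal its coordinates.\<close>

lemma positive_word_point_inj:
  assumes w: "w \<in> word_simplices n S p" "t \<in> standard_simplex p" "\<forall>k\<le>p. t k > 0"
    and v: "v \<in> word_simplices n S q" "s \<in> standard_simplex q" "\<forall>k\<le>q. s k > 0"
    and eq: "word_point ((p, w), t) = word_point ((q, v), s)"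
  shows "((p, w), t) = ((q, v), s)"
proof -
  note wD = word_simplicesD[OF w(1)] and vD = word_simplicesD[OF v(1)]
  have support: "letter_weight u r i \<noteq> 0 \<longleftrightarrow> i \<in> set u"
    if "distinct u" "length u = Suc l" "\<And>k. k \<le> l \<Longrightarrow> r k > 0" for u r l i
    using that letter_weight_nth[OF that(1), of _ r] letter_weight_notin[of i u r]
    by (force simp: in_set_conv_nth less_Suc_eq_le)
  have tnn: "0 \<le> t k" for k
    using w(2) by (auto simp: standard_simplex_def)
  have weights: "letter_weight w t = letter_weight v s"
    and ord: "\<And>i j. \<lbrakk>letter_weight w t i \<noteq> 0; letter_weight w t j \<noteq> 0\<rbrakk> \<Longrightarrow>
      position w i \<le> position w j \<longleftrightarrow> position v i \<le> position v j"
    using eq by (simp_all add: word_point_def order_point_eq_iff letter_weight_nonneg tnn)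
  have supp_w: "letter_weight w t i \<noteq> 0 \<longleftrightarrow> i \<in> set w"
    and supp_v: "letter_weight v s i \<noteq> 0 \<longleftrightarrow> i \<in> set v" for i
    using support wD(1,3) vD(1,3) w(3) v(3) by blast+
  have "set w = set v"
    using supp_w supp_v weights by auto
  with wD(1) vD(1) have wv: "w = v"
    by (rule eq_if_same_position_order) (use ord supp_w \<open>set w = set v\<close> in auto)
  with wD(3) vD(3) have pq: "p = q" by simp
  have "t k = s k" for k
  proof (cases "k < length w")
    case True
    then show ?thesis
      using letter_weight_nth[OF wD(1)] weights wv by metis
  qed (use w(2) v(2) wD(3) pq in \<open>auto simp: standard_simplex_def\<close>)
  then show ?thesis
    using wv pq by auto
qed

text \<open>Passing to interior representatives does not change \<open>word_point\<close>, so the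
  two representatives coincide and link the given points.\<close>

lemma word_point_eq_imp_equivclp:
  assumes w: "w \<in> word_simplices n S p" "t \<in> standard_simplex p"
    and v: "v \<in> word_simplices n S q" "s \<in> standard_simplex q"
    and eq: "word_point ((p, w), t) = word_point ((q, v), s)"
  shows "equivclp (face_identification (word_simplices n S) word_face) ((p, w), t) ((q, v), s)"
proof -
  let ?R = "face_identification (word_simplices n S) word_face"
  note rep = equivclp_positive_representative[OF semisimplicial_word_simplices]
  have resp: "word_point z = word_point z'" if "equivclp ?R z z'" for z z'
    using that by (induction rule: equivclp_induct) (auto dest: word_point_face_identification)
  obtain p' w' t' where w': "w' \<in> word_simplices n S p'" "t' \<in> standard_simplex p'"
    "\<forall>k\<le>p'. t' k > 0" and eqw: "equivclp ?R ((p, w), t) ((p', w'), t')"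
    by (rule rep[OF w]) (rule that)
  obtain q' v' s' where v': "v' \<in> word_simplices n S q'" "s' \<in> standard_simplex q'"
    "\<forall>k\<le>q'. s' k > 0" and eqv: "equivclp ?R ((q, v), s) ((q', v'), s')"
    by (rule rep[OF v]) (rule that)
  have "((p', w'), t') = ((q', v'), s')"
    using resp[OF eqw] resp[OF eqv] eq by (intro positive_word_point_inj[OF w' v']) simp_all
  then show ?thesis
    using equivclp_trans[OF eqw] equivclp_sym[OF eqv] by simp
qed

section \<open>The image of the realization\<close>

lemma distinct_perm_word:
  assumes "\<sigma> permutes {1..n}"
  shows "distinct (perm_word n \<sigma>)"
  by (simp add: perm_word_def distinct_map inj_on_subset[OF permutes_inj[OF assms]] del: upt_Suc)

text \<open>Places in a list count from 0, arguments of the permutation from 1.\<close>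

lemma position_perm_word:
  assumes \<sigma>: "\<sigma> permutes {1..n}" and i: "i \<in> {1..n}"
  shows "position (perm_word n \<sigma>) i = inv_into UNIV \<sigma> i - 1"
proof -
  have "inv_into UNIV \<sigma> i \<in> {1..n}"
    using permutes_in_image[OF permutes_inv[OF \<sigma>]] i by blast
  then have k: "inv_into UNIV \<sigma> i - 1 < length (perm_word n \<sigma>)" "perm_word n \<sigma> ! (inv_into UNIV \<sigma> i - 1) = i"
    using permutes_inverses(1)[OF \<sigma>] by (auto simp: perm_word_def simp del: upt_Suc)
  show ?thesis
    using position_nth[OF distinct_perm_word[OF \<sigma>] k(1)] k(2) by simp
qed

text \<open>Letters in the support have inverse values at least 1, so the truncated subtraction of
  one preserves their order.\<close>

lemma order_point_perm_word:
  assumes \<sigma>: "\<sigma> permutes {1..n}" and T: "T \<in> letter_simplex n"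
  shows "order_point (position (perm_word n \<sigma>)) T = order_point (inv_into UNIV \<sigma>) T"
proof -
  have "position (perm_word n \<sigma>) i \<le> position (perm_word n \<sigma>) j \<longleftrightarrow> inv_into UNIV \<sigma> i \<le> inv_into UNIV \<sigma> j"
    if "T i \<noteq> 0" "T j \<noteq> 0" for i j
  proof -
    have ij: "i \<in> {1..n}" "j \<in> {1..n}"
      using that letter_simplexD(2)[OF T] by blast+
    then have "inv_into UNIV \<sigma> i \<in> {1..n}" "inv_into UNIV \<sigma> j \<in> {1..n}"
      using permutes_in_image[OF permutes_inv[OF \<sigma>]] by blast+
    then show ?thesis
      using ij by (auto simp: position_perm_word[OF \<sigma>])
  qed
  then show ?thesis
    using letter_simplexD(1)[OF T] by (subst order_point_eq_iff) auto
qed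

lemma letter_weight_in_letter_simplex:
  assumes w: "set w \<subseteq> {1..n}" "length w = Suc p" and t: "t \<in> standard_simplex p"
  shows "letter_weight w t \<in> letter_simplex n"
  unfolding letter_simplex_def
proof (intro CollectI conjI allI impI)
  show "0 \<le> letter_weight w t i" for i
    using t by (intro letter_weight_nonneg) (auto simp: standard_simplex_def)
  show "letter_weight w t i = 0" if "i \<notin> {1..n}" for i
    using that w by (intro letter_weight_notin) auto
  have "(\<Sum>i=1..n. letter_weight w t i) = (\<Sum>k<length w. \<Sum>i=1..n. if w ! k = i then t k else 0)"
    unfolding letter_weight_def by (rule sum.swap)
  also have "\<dots> = (\<Sum>k<length w. t k)"
  proof (rule sum.cong[OF refl])
    fix k assume "k \<in> {..<length w}"
    then have "w ! k \<in> {1..n}"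
      using w(1) nth_mem by blast
    then show "(\<Sum>i=1..n. if w ! k = i then t k else 0) = t k"
      by simp
  qed
  also have "\<dots> = 1"
    using t w(2) by (simp add: standard_simplex_def lessThan_Suc_atMost)
  finally show "(\<Sum>i=1..n. letter_weight w t i) = 1" .
qed

text \<open>A word lies below some generating \<open>perm_word n \<sigma>\<close>, which puts its
  points into the facet of \<open>\<sigma>\<close>; conversely, every point of that facet comes from
  the top simplex of \<open>\<sigma>\<close> itself.\<close>

lemma word_point_image:
  assumes n: "n \<ge> 1" and S: "S \<subseteq> perms n"
  shows "word_point ` (SIGMA px:Sigma UNIV (word_simplices n S). standard_simplex (fst px))
    = (\<Union>\<sigma>\<in>S. facet n (inv_into UNIV \<sigma>))" (is "?L = ?R")
proof
  show "?L \<subseteq> ?R"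
  proof clarsimp
    fix p w t assume w: "w \<in> word_simplices n S p" and t: "t \<in> standard_simplex p"
    note wD = word_simplicesD[OF w]
    obtain \<sigma> where \<sigma>: "\<sigma> \<in> S" "subseq w (perm_word n \<sigma>)"
      using wD(4) by blast
    then have perm: "\<sigma> permutes {1..n}"
      using S by (auto simp: perms_def)
    have dist: "distinct (perm_word n \<sigma>)"
      using perm by (rule distinct_perm_word)
    have lw: "letter_weight w t \<in> letter_simplex n"
      using letter_weight_in_letter_simplex wD t by blast
    have "word_point ((p, w), t) = order_point (inv_into UNIV \<sigma>) (letter_weight w t)"
      using order_point_subseq[OF \<sigma>(2) dist, of t] t order_point_perm_word[OF perm lw]
      by (simp add: word_point_def standard_simplex_def)
    then show "\<exists>\<sigma>\<in>S. word_point ((p, w), t) \<in> facet n (inv_into UNIV \<sigma>)"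
      using \<sigma>(1) lw by (auto simp: facet_def)
  qed
  show "?R \<subseteq> ?L"
  proof clarify
    fix x \<sigma> assume \<sigma>: "\<sigma> \<in> S" and "x \<in> facet n (inv_into UNIV \<sigma>)"
    then obtain T where T: "T \<in> letter_simplex n" and x: "x = order_point (inv_into UNIV \<sigma>) T"
      by (auto simp: facet_def)
    have perm: "\<sigma> permutes {1..n}"
      using S \<sigma> by (auto simp: perms_def)
    let ?w = "perm_word n \<sigma>"
    \<comment> \<open>\<open>T\<close> is read along the word, whose place \<open>k\<close> holds
      \<open>\<sigma> (Suc k)\<close>, and continued by zero as a point of the standard simplex
      requires.\<close>
    define t where "t k = (if k < n then T (\<sigma> (Suc k)) else 0)" for k
    have len: "length ?w = n"
      by (simp add: perm_word_def)
    have nth: "?w ! k = \<sigma> (Suc k)" if "k < n" for k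
      using that by (simp add: perm_word_def del: upt_Suc)
    have set: "set ?w = {1..n}"
      using permutes_image[OF perm] by (simp add: perm_word_def atLeastLessThanSuc_atLeastAtMost del: upt_Suc)
    have dist: "distinct ?w"
      using perm by (rule distinct_perm_word)
    have "?w \<in> word_simplices n S (n - 1)"
      using n len set dist \<sigma> by (auto simp: word_simplices_def generated_words_def injective_word_def)
    moreover have "t \<in> standard_simplex (n - 1)"
    proof -
      have "(\<Sum>k\<le>n - 1. t k) = (\<Sum>i=1..n. T (\<sigma> i))"
        by (rule sum.reindex_bij_witness[of _ "\<lambda>i. i - 1" Suc]) (use n in \<open>auto simp: t_def\<close>)
      also have "\<dots> = (\<Sum>i=1..n. T i)"
        using sum.permute[OF perm, of T] by simp
      finally show ?thesis
        using n letter_simplexD[OF T] letter_simplex_le_1[OF T] by (auto simp: standard_simplex_def t_def)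
    qed
    moreover have "letter_weight ?w t = T"
    proof
      fix i
      show "letter_weight ?w t i = T i"
      proof (cases "i \<in> {1..n}")
        case True
        then obtain k where "k < n" "i = ?w ! k"
          using set len by (metis in_set_conv_nth)
        then show ?thesis
          using letter_weight_nth[OF dist, of k t] len nth by (simp add: t_def)
      next
        case False
        then show ?thesis
          using letter_weight_notin[of i ?w t] set letter_simplexD(2)[OF T] by auto
      qed
    qed
    then have "x = word_point ((n - 1, ?w), t)"
      using x order_point_perm_word[OF perm T] by (simp add: word_point_def)
    ultimately show "x \<in> ?L"
      by force
  qed
qed

lemma finite_word_simplices: "finite (Sigma UNIV (word_simplices n S))"
proof (rule finite_subset)
  show "Sigma UNIV (word_simplices n S) \<subseteq>
      (\<lambda>w. (length w - 1, w)) ` {w. set w \<subseteq> {1..n} \<and> distinct w}"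
    using word_simplicesD by (fastforce simp: image_iff)
qed (simp add: finite_subset_distinct)

lemma injective_word_complex_homeomorphic_facets:
  assumes "n \<ge> 1" "S \<subseteq> perms n"
  shows "injective_word_complex n S homeomorphic_space top_of_set (\<Union>\<sigma>\<in>S. facet n (inv_into UNIV \<sigma>))"
  unfolding injective_word_complex_def word_point_image[OF assms, symmetric]
proof (rule geometric_realization_homeomorphic_image)
  show "finite (Sigma UNIV (word_simplices n S))"
    by (rule finite_word_simplices)
  show "continuous_on (standard_simplex p) (\<lambda>t. word_point ((p, w), t))" for p w
    by (rule continuous_on_word_point)
  show "word_point z = word_point z'"
    if "face_identification (word_simplices n S) word_face z z'" for z z'
    using that by (rule word_point_face_identification)
qed (rule word_point_eq_imp_equivclp)

text \<open>A permutation and its inverse have the same fixed points.\<close>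

lemma inv_nonderangements: "inv_into UNIV ` (perms n - derangements n) = fixing_perms n"
proof
  show "inv_into UNIV ` (perms n - derangements n) \<subseteq> fixing_perms n"
    by (auto simp: perms_def derangements_def fixing_perms_def permutes_inv)
      (metis permutes_inverses(2) atLeastAtMost_iff)
  show "fixing_perms n \<subseteq> inv_into UNIV ` (perms n - derangements n)"
  proof
    fix p assume "p \<in> fixing_perms n"
    then obtain a where p: "p permutes {1..n}" and a: "a \<in> {1..n}" "p a = a"
      by (auto simp: fixing_perms_def)
    have "inv_into UNIV p a = a"
      using permutes_inverses(2)[OF p, of a] a by simp
    then have "inv_into UNIV p \<in> perms n - derangements n"
      using p a by (auto simp: perms_def derangements_def permutes_inv)
    then show "p \<in> inv_into UNIV ` (perms n - derangements n)"
      using permutes_inv_inv[OF p] by (metis imageI)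
  qed
qed

theorem theoremA:
  fixes n :: nat
  assumes "n \<ge> 1"
  shows "contractible_space (injective_word_complex n (perms n - derangements n))"
proof -
  let ?S = "perms n - derangements n"
  \<comment> \<open>The set of all permutations with a fixed point is trivially closed downwards;
    the identity makes it nonempty.\<close>
  have "id \<in> fixing_perms n"
    using assms by (auto simp: fixing_perms_def permutes_id)
  then have "contractible_space (top_of_set (\<Union>p\<in>fixing_perms n. facet n p))"
    by (intro contractible_space_facets) auto
  also have "(\<Union>p\<in>fixing_perms n. facet n p) = (\<Union>\<sigma>\<in>?S. facet n (inv_into UNIV \<sigma>))"
    by (simp add: inv_nonderangements[symmetric])
  finally show ?thesis
    using homeomorphic_space_contractibility[OF injective_word_complex_homeomorphic_facets[OF assms, of ?S]]
    by auto
qed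

end
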